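(* Let $v>k\ge 3$ be integers with $\gcd(v,k)=1$. Assume that there exists a simple $3-(v,2k,\Lambda)$ design such that $$m=\frac{\Lambda}{2\binom{v-3}{k-2}}$$ is an integer and $m\le \frac1k\binom{v-1}{k-1}$. Then there exists a simple $3-\bigl(2v,2k,\tfrac{k(v-2)}{2(v-k)}\Lambda\bigr)$ design.
   Context: A $t-(v,k,\lambda)$ design is a pair $(X,\mathcal B)$ with $|X|=v$ and $\mathcal B$ a collection of $k$-subsets (blocks) of $X$ such that every $t$-subset of $X$ is contained in exactly $\lambda$ blocks. It is simple if it has no repeated blocks. *)

theory Defs
  imports Complex_Main "HOL-Library.Multiset"
begin

text \<open>Blocks form a multiset, so that a design may have repeated blocks and
  \<open>simple_blocks\<close> is a genuine condition.\<close>

definition t_design ::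
  "nat \<Rightarrow> nat \<Rightarrow> nat \<Rightarrow> nat \<Rightarrow> 'a set \<Rightarrow> 'a set multiset \<Rightarrow> bool" where
  "t_design t v k l X \<B> \<longleftrightarrow>
     finite X \<and> card X = v \<and>
     (\<forall>b \<in># \<B>. b \<subseteq> X \<and> card b = k) \<and>
     (\<forall>T. T \<subseteq> X \<and> card T = t \<longrightarrow> size {#b \<in># \<B>. T \<subseteq> b#} = l)"

definition simple_blocks :: "'a set multiset \<Rightarrow> bool" where
  "simple_blocks \<B> \<longleftrightarrow> (\<forall>b. count \<B> b \<le> 1)"

definition simple_t_design ::
  "nat \<Rightarrow> nat \<Rightarrow> nat \<Rightarrow> nat \<Rightarrow> 'a set \<Rightarrow> 'a set multiset \<Rightarrow> bool" where
  "simple_t_design t v k l X \<B> \<longleftrightarrow> t_design t v k l X \<B> \<and> simple_blocks \<B>"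

end

theory Submission
  imports Defs "HOL-Number_Theory.Cong" "HOL-Library.FuncSet"
begin

text \<open>
  The new design lives on two disjoint copies of the \<open>v\<close> points. Its blocks are the blocks of the
  given design in the first copy, the same blocks in the second copy, and certain mixed blocks
  \<open>A <+> B\<close>, where \<open>A\<close> and \<open>B\<close> are \<open>k\<close>-subsets of the two copies.

  The mixed blocks come from translating \<open>k\<close>-subsets of the cyclic group of order \<open>v\<close>. Translation
  by \<open>s\<close> adds \<open>k * s\<close> to the sum of the elements, so that coprimality of \<open>v\<close> and \<open>k\<close> makes every
  translation class have exactly \<open>v\<close> members, with each point in exactly \<open>k\<close> of them
  (\<open>equipoint_colouring_exists\<close>). Counting the \<open>k\<close>-subsets through one point shows that there are
  \<open>N = (1/k) * (v - 1 choose k - 1)\<close> classes. The hypothesis \<open>m \<le> N\<close> is exactly what allows a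
  symmetric relation on the classes in which each class is related to \<open>m\<close> classes
  (\<open>card_linked\<close>), and the mixed blocks are the \<open>A <+> B\<close> whose classes are related.

  For a fixed \<open>A\<close>, the number of partners \<open>B\<close> is \<open>m * v\<close>, and the number of partners through a
  given point is \<open>m * k\<close>. Hence a triple with two points in one copy and one in the other lies in
  \<open>(v - 2 choose k - 2) * m * k\<close> blocks, and a triple inside one copy lies in
  \<open>\<Lambda> + (v - 3 choose k - 3) * m * v\<close> blocks. The value of \<open>\<Lambda>\<close> in terms of \<open>m\<close> is the one for which
  these two numbers agree, by the identity \<open>k * (v - 2) - v * (k - 2) = 2 * (v - k)\<close> and the ratios
  of neighbouring binomial coefficients (\<open>binomial_ratios\<close>).
\<close>

section \<open>Designs as sets of blocks\<close>

text \<open>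
  A simple design is determined by its set of blocks. Counting is easier with sets than with
  multisets, and simplicity is then automatic.
\<close>

definition family_design ::
  "nat \<Rightarrow> nat \<Rightarrow> nat \<Rightarrow> nat \<Rightarrow> 'a set \<Rightarrow> 'a set set \<Rightarrow> bool" where
  "family_design t v k l X F \<longleftrightarrow>
     finite X \<and> card X = v \<and> (\<forall>b\<in>F. b \<subseteq> X \<and> card b = k) \<and>
     (\<forall>T. T \<subseteq> X \<and> card T = t \<longrightarrow> card {b\<in>F. T \<subseteq> b} = l)"

lemma family_design_of_simple_t_design:
  assumes "simple_t_design t v k l X \<B>"
  shows "family_design t v k l X (set_mset \<B>)"
proof -
  have le1: "count \<B> b \<le> 1" for b
    using assms by (simp add: simple_t_design_def simple_blocks_def)
  have cnt: "count \<B> b = 1" if "b \<in># \<B>" for b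
    using le1[of b] that by (metis One_nat_def count_eq_zero_iff le_Suc_eq le_zero_eq)
  have "size {#b \<in># \<B>. T \<subseteq> b#} = card {b \<in> set_mset \<B>. T \<subseteq> b}" for T
  proof -
    have "size {#b \<in># \<B>. T \<subseteq> b#} = (\<Sum>b\<in>{b \<in> set_mset \<B>. T \<subseteq> b}. count {#b \<in># \<B>. T \<subseteq> b#} b)"
      by (simp add: size_multiset_overloaded_eq)
    also have "\<dots> = (\<Sum>b\<in>{b \<in> set_mset \<B>. T \<subseteq> b}. 1)"
      by (rule sum.cong) (auto simp: cnt)
    finally show ?thesis by simp
  qed
  then show ?thesis
    using assms by (simp add: simple_t_design_def t_design_def family_design_def)
qed

lemma family_design_finite: "family_design t v k l X F \<Longrightarrow> finite F"
  unfolding family_design_def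
  by (metis (no_types, lifting) Pow_iff finite_Pow_iff finite_subset subsetI)

lemma simple_t_design_of_family_design:
  assumes "family_design t v k l X F"
  shows "simple_t_design t v k l X (mset_set F)"
  using assms family_design_finite[OF assms]
  by (auto simp: simple_t_design_def t_design_def family_design_def simple_blocks_def
      filter_mset_mset_set count_mset_set')

lemma family_design_transport:
  assumes "family_design t v k l X F" and "bij_betw h X Y"
  shows "family_design t v k l Y ((`) h ` F)"
proof -
  have inj: "inj_on h X" and img: "h ` X = Y" using assms(2) by (auto simp: bij_betw_def)
  have fin: "finite X" and F: "\<And>b. b \<in> F \<Longrightarrow> b \<subseteq> X \<and> card b = k"
    and bal: "\<And>T. T \<subseteq> X \<Longrightarrow> card T = t \<Longrightarrow> card {b\<in>F. T \<subseteq> b} = l"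
    and cX: "card X = v"
    using assms(1) by (auto simp: family_design_def)
  have injP: "inj_on ((`) h) (Pow X)"
    by (rule inj_on_image_Pow[OF inj])
  have "card {c \<in> (`) h ` F. T \<subseteq> c} = l" if T: "T \<subseteq> Y" "card T = t" for T
  proof -
    obtain S where S: "S \<subseteq> X" "T = h ` S" using T(1) img by (metis subset_imageE)
    have "card S = t" using S T(2) inj by (metis card_image inj_on_subset)
    then have SF: "card {b\<in>F. S \<subseteq> b} = l" by (rule bal[OF S(1)])
    have "h ` S \<subseteq> h ` b \<longleftrightarrow> S \<subseteq> b" if "b \<in> F" for b
      using S(1) F[OF that] inj_on_image_mem_iff[OF inj]
      by (metis image_mono image_subset_iff subset_iff)
    then have "{c \<in> (`) h ` F. T \<subseteq> c} = (`) h ` {b\<in>F. S \<subseteq> b}"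
      unfolding S(2) by blast
    moreover have "inj_on ((`) h) {b\<in>F. S \<subseteq> b}"
      by (rule inj_on_subset[OF injP]) (use F in blast)
    ultimately show ?thesis unfolding SF[symmetric] by (simp only: card_image)
  qed
  moreover have "card (h ` b) = k" if "b \<in> F" for b
    using F[OF that] inj by (metis card_image inj_on_subset)
  ultimately show ?thesis
    using fin cX F img card_image[OF inj] unfolding family_design_def by blast
qed

section \<open>Subsets of given size containing a given set\<close>

lemma card_supersets_of_size:
  assumes "finite X" and "P \<subseteq> X" and "card P \<le> k"
  shows "card {A. A \<subseteq> X \<and> card A = k \<and> P \<subseteq> A} = (card X - card P) choose (k - card P)"
proof -
  have finP: "finite P" using assms finite_subset by blast
  have "bij_betw (\<lambda>B. B \<union> P) {B. B \<subseteq> X - P \<and> card B = k - card P}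
      {A. A \<subseteq> X \<and> card A = k \<and> P \<subseteq> A}"
  proof (rule bij_betwI[where g = "\<lambda>A. A - P"])
    show "(\<lambda>B. B \<union> P) \<in> {B. B \<subseteq> X - P \<and> card B = k - card P}
        \<rightarrow> {A. A \<subseteq> X \<and> card A = k \<and> P \<subseteq> A}"
    proof
      fix B assume "B \<in> {B. B \<subseteq> X - P \<and> card B = k - card P}"
      then have B: "B \<subseteq> X - P" "card B = k - card P" by auto
      have "card (B \<union> P) = card B + card P"
        using B finP assms(1) by (intro card_Un_disjoint) (auto intro: finite_subset)
      then show "B \<union> P \<in> {A. A \<subseteq> X \<and> card A = k \<and> P \<subseteq> A}"
        using B assms by auto
    qed
  qed (use finP in \<open>auto simp: card_Diff_subset\<close>)
  then have "card {A. A \<subseteq> X \<and> card A = k \<and> P \<subseteq> A} = card {B. B \<subseteq> X - P \<and> card B = k - card P}"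
    by (rule bij_betw_same_card[symmetric])
  also have "\<dots> = card (X - P) choose (k - card P)"
    using assms(1) by (intro n_subsets) auto
  finally show ?thesis using assms finP by (simp add: card_Diff_subset)
qed

section \<open>Translation classes of subsets of a cyclic group\<close>

definition shift :: "int \<Rightarrow> int \<Rightarrow> int set \<Rightarrow> int set" where
  "shift n s A = (\<lambda>x. (x + s) mod n) ` A"

lemma shift_shift: "shift n s (shift n t A) = shift n (s + t) A"
  by (simp add: shift_def image_image mod_simps algebra_simps)

lemma shift_cong: "[s = t] (mod n) \<Longrightarrow> shift n s A = shift n t A"
  unfolding shift_def by (intro image_cong) (auto simp: cong_def intro: mod_add_cong)

lemma shift_0: "A \<subseteq> {0..<n} \<Longrightarrow> shift n 0 A = A"
  by (force simp: shift_def image_def)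

lemma shift_subset: "n > 0 \<Longrightarrow> shift n s A \<subseteq> {0..<n}"
  by (auto simp: shift_def)

lemma inj_on_add_mod: "inj_on (\<lambda>x. (x + s) mod n) {0..<n :: int}"
proof (rule inj_onI)
  fix x y assume xy: "x \<in> {0..<n}" "y \<in> {0..<n}" "(x + s) mod n = (y + s) mod n"
  then have "[x = y] (mod n)" by (metis cong_add_rcancel cong_def)
  then show "x = y" using xy by (simp add: cong_def)
qed

lemma card_shift: "A \<subseteq> {0..<n} \<Longrightarrow> card (shift n s A) = card A"
  unfolding shift_def by (intro card_image inj_on_subset[OF inj_on_add_mod])

lemma sum_shift_cong:
  assumes "A \<subseteq> {0..<n}"
  shows "[\<Sum>(shift n s A) = \<Sum>A + int (card A) * s] (mod n)"
proof -
  have "\<Sum>(shift n s A) = (\<Sum>x\<in>A. (x + s) mod n)"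
    unfolding shift_def
    by (subst sum.reindex) (auto intro: inj_on_subset[OF inj_on_add_mod assms])
  also have "[\<dots> = (\<Sum>x\<in>A. x + s)] (mod n)"
    by (intro cong_sum) (simp add: cong_def)
  finally show ?thesis by (simp add: sum.distrib)
qed

text \<open>
  The sums of the two translates differ by \<open>card A * (s - t)\<close>, and \<open>card A\<close> is invertible
  modulo \<open>n\<close>.
\<close>

lemma shift_eq_imp_eq:
  assumes "A \<subseteq> {0..<n}" and "coprime (int (card A)) n"
    and "s \<in> {0..<n}" "t \<in> {0..<n}" and "shift n s A = shift n t A"
  shows "s = t"
proof -
  have "[\<Sum>A + int (card A) * s = \<Sum>A + int (card A) * t] (mod n)"
    using sum_shift_cong[OF assms(1)] assms(5) by (metis cong_sym cong_trans)
  then have "[s = t] (mod n)"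
    using assms(2) by (simp add: cong_add_lcancel cong_mult_lcancel)
  then show ?thesis using assms by (simp add: cong_def)
qed

text \<open>The translates of \<open>A\<close> through \<open>z\<close> are those by \<open>z - x\<close> for \<open>x\<close> in \<open>A\<close>.\<close>

lemma card_shifts_containing:
  assumes "n > 0" and "A \<subseteq> {0..<n}" and "z \<in> {0..<n}"
  shows "card {s \<in> {0..<n}. z \<in> shift n s A} = card A"
proof -
  have "bij_betw (\<lambda>x. (z - x) mod n) A {s \<in> {0..<n}. z \<in> shift n s A}"
  proof (rule bij_betwI[where g = "\<lambda>s. (z - s) mod n"])
    show "(\<lambda>x. (z - x) mod n) \<in> A \<rightarrow> {s \<in> {0..<n}. z \<in> shift n s A}"
      using assms by (force simp: shift_def image_def mod_simps)
    show "(\<lambda>s. (z - s) mod n) \<in> {s \<in> {0..<n}. z \<in> shift n s A} \<rightarrow> A"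
    proof
      fix s assume "s \<in> {s \<in> {0..<n}. z \<in> shift n s A}"
      then obtain x where x: "x \<in> A" "z = (x + s) mod n" by (auto simp: shift_def)
      have "(z - s) mod n = x mod n" unfolding x by (simp add: mod_simps)
      then show "(z - s) mod n \<in> A" using x(1) assms(2) by (auto simp: subset_eq)
    qed
  qed (use assms in \<open>auto simp: mod_simps subset_eq\<close>)
  then show ?thesis by (simp add: bij_betw_same_card)
qed

text \<open>
  Each colour class is the block set of a 1-design with \<open>card X\<close> blocks of size \<open>k\<close>, so the colouring
  partitions the complete design of \<open>k\<close>-subsets into 1-designs of equal size.
\<close>

definition equipoint_colouring :: "'a set \<Rightarrow> nat \<Rightarrow> nat \<Rightarrow> ('a set \<Rightarrow> nat) \<Rightarrow> bool" where
  "equipoint_colouring X k N f \<longleftrightarrow>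
     (\<forall>A. A \<subseteq> X \<and> card A = k \<longrightarrow> f A < N) \<and>
     (\<forall>i<N. card {A. A \<subseteq> X \<and> card A = k \<and> f A = i} = card X) \<and>
     (\<forall>i<N. \<forall>z\<in>X. card {A. A \<subseteq> X \<and> card A = k \<and> f A = i \<and> z \<in> A} = k)"

text \<open>
  The colour classes are the translation classes. Every class has exactly one member whose sum is
  \<open>0\<close> modulo \<open>v\<close>, since translation by \<open>s\<close> changes the sum by \<open>k * s\<close> and \<open>k\<close> is a unit; the map
  \<open>norm\<close> picks this member as the name of the class.
\<close>

lemma equipoint_colouring_exists:
  assumes "coprime v k" and "v > 0"
  obtains f N where "equipoint_colouring {0..<int v} k N f"
proof -
  define n where "n = int v"
  have n: "n > 0" using assms(2) by (simp add: n_def)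
  define Z where "Z = {0..<n}"
  define K where "K = {A. A \<subseteq> Z \<and> card A = k}"
  have cop: "coprime (int k) n" using assms(1) by (simp add: n_def coprime_commute)
  obtain c where c: "[int k * c = 1] (mod n)"
    using cong_solve_coprime_int[OF cop] by blast
  define norm where "norm = (\<lambda>A. shift n (- c * \<Sum>A) A)"
  have shiftK: "shift n s A \<in> K" if "A \<in> K" for s A
    using that shift_subset[OF n] card_shift by (auto simp: K_def Z_def)
  have norm_shift: "norm (shift n s A) = norm A" if "A \<in> K" for s A
  proof -
    have A: "A \<subseteq> {0..<n}" "card A = k" using that by (auto simp: K_def Z_def)
    have "[- c * \<Sum>(shift n s A) + s = - c * (\<Sum>A + int k * s) + s] (mod n)"
      using sum_shift_cong[OF A(1), of s] A(2) by (intro cong_add cong_mult) auto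
    also have "- c * (\<Sum>A + int k * s) + s = - c * \<Sum>A - (int k * c) * s + s"
      by (simp add: algebra_simps)
    also have "[\<dots> = - c * \<Sum>A - 1 * s + s] (mod n)"
      using c by (intro cong_add cong_diff cong_mult) auto
    finally have "[- c * \<Sum>(shift n s A) + s = - c * \<Sum>A] (mod n)" by simp
    then show ?thesis unfolding norm_def shift_shift by (rule shift_cong)
  qed
  have fibre: "{B\<in>K. norm B = norm A} = (\<lambda>s. shift n s A) ` Z" if A: "A \<in> K" for A
  proof
    show "(\<lambda>s. shift n s A) ` Z \<subseteq> {B\<in>K. norm B = norm A}"
      using A shiftK norm_shift by auto
    show "{B\<in>K. norm B = norm A} \<subseteq> (\<lambda>s. shift n s A) ` Z"
    proof
      fix B assume "B \<in> {B\<in>K. norm B = norm A}"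
      then have B: "B \<in> K" "norm B = norm A" by auto
      have "B = shift n 0 B" using B(1) by (simp add: shift_0 K_def Z_def)
      also have "\<dots> = shift n (c * \<Sum>B) (norm B)" by (simp add: norm_def shift_shift)
      also have "\<dots> = shift n (c * \<Sum>B - c * \<Sum>A) A"
        unfolding B(2) by (simp add: norm_def shift_shift)
      also have "\<dots> = shift n ((c * \<Sum>B - c * \<Sum>A) mod n) A"
        by (rule shift_cong) (simp add: cong_def)
      finally show "B \<in> (\<lambda>s. shift n s A) ` Z" using n by (auto simp: Z_def)
    qed
  qed
  have inj: "inj_on (\<lambda>s. shift n s A) Z" if "A \<in> K" for A
    using that cop shift_eq_imp_eq[of A n] by (auto simp: K_def Z_def intro!: inj_onI)
  have "finite K" by (rule finite_subset[of _ "Pow Z"]) (auto simp: K_def Z_def)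
  then obtain g where g: "bij_betw g (norm ` K) {..<card (norm ` K)}"
    using ex_bij_betw_finite_nat[of "norm ` K"] by (auto simp: atLeast0LessThan)
  let ?N = "card (norm ` K)" and ?f = "\<lambda>A. g (norm A)"
  have same: "(?f B = ?f A) = (norm B = norm A)" if "A \<in> K" "B \<in> K" for A B
    using g that by (auto simp: bij_betw_def inj_on_def)
  have onto: "\<exists>A\<in>K. ?f A = i" if "i < ?N" for i
  proof -
    have "i \<in> g ` norm ` K" using g that by (simp add: bij_betw_def)
    then show ?thesis by blast
  qed
  have "equipoint_colouring Z k ?N ?f"
    unfolding equipoint_colouring_def
  proof (intro conjI allI ballI impI)
    fix A assume "A \<subseteq> Z \<and> card A = k"
    then have "A \<in> K" by (simp add: K_def)
    then show "?f A < ?N" using g by (auto simp: bij_betw_def)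
  next
    fix i assume "i < ?N"
    then obtain A where A: "A \<in> K" "?f A = i" using onto by blast
    have "{B. B \<subseteq> Z \<and> card B = k \<and> ?f B = i} = {B\<in>K. norm B = norm A}"
      using A same by (auto simp: K_def)
    then show "card {B. B \<subseteq> Z \<and> card B = k \<and> ?f B = i} = card Z"
      using fibre[OF A(1)] inj[OF A(1)] by (simp add: card_image)
  next
    fix i z assume "i < ?N" and z: "z \<in> Z"
    then obtain A where A: "A \<in> K" "?f A = i" using onto by blast
    have "{B. B \<subseteq> Z \<and> card B = k \<and> ?f B = i \<and> z \<in> B} = {B\<in>{B\<in>K. norm B = norm A}. z \<in> B}"
      using A same by (auto simp: K_def)
    also have "\<dots> = (\<lambda>s. shift n s A) ` {s\<in>Z. z \<in> shift n s A}"
      unfolding fibre[OF A(1)] by auto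
    finally have "card {B. B \<subseteq> Z \<and> card B = k \<and> ?f B = i \<and> z \<in> B}
        = card {s\<in>Z. z \<in> shift n s A}"
      using inj_on_subset[OF inj[OF A(1)], of "{s\<in>Z. z \<in> shift n s A}"]
      by (simp add: card_image)
    also have "\<dots> = k"
      using card_shifts_containing[OF n, of A z] A(1) z by (simp add: K_def Z_def)
    finally show "card {B. B \<subseteq> Z \<and> card B = k \<and> ?f B = i \<and> z \<in> B} = k" .
  qed
  then show thesis using that by (simp add: Z_def n_def)
qed

text \<open>
  Count the \<open>k\<close>-subsets through one point: each colour contributes \<open>k\<close> of them.
\<close>

lemma equipoint_colouring_card:
  assumes "equipoint_colouring X k N f" and "finite X" and "X \<noteq> {}" and "k \<ge> 1"
  shows "N * k = (card X - 1) choose (k - 1)"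
proof -
  obtain z where z: "z \<in> X" using assms(3) by blast
  let ?C = "\<lambda>i. {A. A \<subseteq> X \<and> card A = k \<and> f A = i \<and> z \<in> A}"
  have "{A. A \<subseteq> X \<and> card A = k \<and> {z} \<subseteq> A} = (\<Union>i<N. ?C i)"
    using assms(1) by (auto simp: equipoint_colouring_def)
  then have "(card X - 1) choose (k - 1) = card (\<Union>i<N. ?C i)"
    using card_supersets_of_size[of X "{z}" k] assms z by simp
  also have "\<dots> = (\<Sum>i<N. card (?C i))"
    using assms(2) by (intro card_UN_disjoint) (auto intro: finite_subset[of _ "Pow X"])
  also have "\<dots> = N * k"
    using assms(1) z by (simp add: equipoint_colouring_def)
  finally show ?thesis by simp
qed

section \<open>Blocks that split evenly between two copies of the points\<close>

text \<open>
  Any symmetric relation on \<open>N\<close> colours with \<open>m\<close> partners for each colour would do. Using the sum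
  \<open>i + j\<close>, not the difference, makes the relation symmetric, so the two copies of the points
  play the same role.
\<close>

definition linked :: "nat \<Rightarrow> nat \<Rightarrow> nat \<Rightarrow> nat \<Rightarrow> bool" where
  "linked N m i j \<longleftrightarrow> (i + j) mod N < m"

lemma linked_commute: "linked N m i j = linked N m j i"
  by (simp add: linked_def add.commute)

lemma card_linked:
  assumes "m \<le> N" and "i < N"
  shows "card {j. j < N \<and> linked N m i j} = m"
proof -
  have i: "i mod N = i" using assms by simp
  have "bij_betw (\<lambda>r. (r + (N - i)) mod N) {..<m} {j. j < N \<and> linked N m i j}"
  proof (rule bij_betwI[where g = "\<lambda>j. (i + j) mod N"])
    show "(\<lambda>r. (r + (N - i)) mod N) \<in> {..<m} \<rightarrow> {j. j < N \<and> linked N m i j}"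
      using assms by (auto simp: linked_def mod_simps)
    fix j assume "j \<in> {j. j < N \<and> linked N m i j}"
    then have "j < N" by simp
    have "((i + j) mod N + (N - i)) mod N = (i + j + (N - i)) mod N"
      by (rule mod_add_left_eq)
    also have "i + j + (N - i) = j + N" using assms(2) by simp
    finally show "((i + j) mod N + (N - i)) mod N = j" using \<open>j < N\<close> by simp
  qed (use assms in \<open>auto simp: linked_def mod_simps\<close>)
  then show ?thesis using bij_betw_same_card by fastforce
qed

text \<open>
  The partners of \<open>A\<close> are the union of \<open>m\<close> colour classes, each of which has \<open>card X\<close> members and
  \<open>k\<close> members through \<open>z\<close>.
\<close>

lemma card_linked_subsets:
  assumes f: "equipoint_colouring X k N f" and "finite X" and "m \<le> N"
    and A: "A \<subseteq> X" "card A = k"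
  shows "card {B. B \<subseteq> X \<and> card B = k \<and> linked N m (f A) (f B)} = m * card X"
    and "z \<in> X \<Longrightarrow>
      card {B. B \<subseteq> X \<and> card B = k \<and> z \<in> B \<and> linked N m (f A) (f B)} = m * k"
proof -
  let ?J = "{j. j < N \<and> linked N m (f A) j}"
  have bound: "\<And>B. B \<subseteq> X \<Longrightarrow> card B = k \<Longrightarrow> f B < N"
    using f by (simp add: equipoint_colouring_def)
  have J: "card ?J = m" using card_linked[OF assms(3) bound[OF A]] .
  have count: "card {B. B \<subseteq> X \<and> card B = k \<and> P B \<and> linked N m (f A) (f B)} = m * r"
    if r: "\<And>i. i < N \<Longrightarrow> card {B. B \<subseteq> X \<and> card B = k \<and> f B = i \<and> P B} = r" for P r
  proof -
    have "{B. B \<subseteq> X \<and> card B = k \<and> P B \<and> linked N m (f A) (f B)}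
        = (\<Union>i\<in>?J. {B. B \<subseteq> X \<and> card B = k \<and> f B = i \<and> P B})"
      using bound by auto
    also have "card \<dots> = (\<Sum>i\<in>?J. card {B. B \<subseteq> X \<and> card B = k \<and> f B = i \<and> P B})"
      using assms(2) by (intro card_UN_disjoint) (auto intro: finite_subset[of _ "Pow X"])
    also have "\<dots> = m * r" using r J by simp
    finally show ?thesis .
  qed
  show "card {B. B \<subseteq> X \<and> card B = k \<and> linked N m (f A) (f B)} = m * card X"
    using count[of "\<lambda>_. True" "card X"] f by (simp add: equipoint_colouring_def)
  show "card {B. B \<subseteq> X \<and> card B = k \<and> z \<in> B \<and> linked N m (f A) (f B)} = m * k"
    if "z \<in> X"
    using count[of "\<lambda>B. z \<in> B" k] f that by (simp add: equipoint_colouring_def)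
qed

definition linked_pairs :: "'a set \<Rightarrow> nat \<Rightarrow> nat \<Rightarrow> nat \<Rightarrow> ('a set \<Rightarrow> nat) \<Rightarrow> ('a set \<times> 'a set) set"
  where "linked_pairs X k N m f =
    {(A, B). A \<subseteq> X \<and> card A = k \<and> B \<subseteq> X \<and> card B = k \<and> linked N m (f A) (f B)}"

lemma card_linked_pairs_swap:
  "card {(A, B) \<in> linked_pairs X k N m f. P \<subseteq> A \<and> Q \<subseteq> B}
    = card {(A, B) \<in> linked_pairs X k N m f. Q \<subseteq> A \<and> P \<subseteq> B}"
  by (rule bij_betw_same_card[of prod.swap], rule bij_betwI[where g = prod.swap])
    (auto simp: linked_pairs_def linked_commute)

text \<open>
  The number of partners of \<open>A\<close> that meet the condition on \<open>B\<close> does not depend on \<open>A\<close>, so the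
  count is the number of choices of \<open>A\<close> times the number of partners. The condition \<open>{} \<subseteq> B\<close>
  is kept so that both parts are instances of the count of pairs with \<open>P \<subseteq> A\<close> and \<open>Q \<subseteq> B\<close>.
\<close>

lemma card_linked_pairs_containing:
  assumes f: "equipoint_colouring X k N f" and X: "finite X" and m: "m \<le> N"
    and P: "P \<subseteq> X" "card P \<le> k"
  shows "card {(A, B) \<in> linked_pairs X k N m f. P \<subseteq> A \<and> {} \<subseteq> B}
      = ((card X - card P) choose (k - card P)) * (m * card X)"
    and "z \<in> X \<Longrightarrow> card {(A, B) \<in> linked_pairs X k N m f. P \<subseteq> A \<and> {z} \<subseteq> B}
      = ((card X - card P) choose (k - card P)) * (m * k)"
proof -
  let ?S = "{A. A \<subseteq> X \<and> card A = k \<and> P \<subseteq> A}"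
  have finS: "finite ?S" using X by (auto intro: finite_subset[of _ "Pow X"])
  have count: "card {(A, B) \<in> linked_pairs X k N m f. P \<subseteq> A \<and> Q \<subseteq> B}
      = ((card X - card P) choose (k - card P)) * r"
    if r: "\<And>A. A \<subseteq> X \<Longrightarrow> card A = k \<Longrightarrow>
      card {B. B \<subseteq> X \<and> card B = k \<and> Q \<subseteq> B \<and> linked N m (f A) (f B)} = r" for Q r
  proof -
    let ?R = "\<lambda>A. {B. B \<subseteq> X \<and> card B = k \<and> Q \<subseteq> B \<and> linked N m (f A) (f B)}"
    have "{(A, B) \<in> linked_pairs X k N m f. P \<subseteq> A \<and> Q \<subseteq> B} = Sigma ?S ?R"
      by (auto simp: linked_pairs_def)
    then have "card {(A, B) \<in> linked_pairs X k N m f. P \<subseteq> A \<and> Q \<subseteq> B} = card (Sigma ?S ?R)"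
      by (rule arg_cong)
    also have "\<dots> = (\<Sum>A\<in>?S. card (?R A))"
      using finS X by (intro card_SigmaI) (auto intro: finite_subset[of _ "Pow X"])
    also have "\<dots> = (\<Sum>A\<in>?S. r)"
      by (rule sum.cong[OF refl], rule r) blast+
    also have "\<dots> = card ?S * r" by simp
    finally show ?thesis unfolding card_supersets_of_size[OF X P] .
  qed
  show "card {(A, B) \<in> linked_pairs X k N m f. P \<subseteq> A \<and> {} \<subseteq> B}
      = ((card X - card P) choose (k - card P)) * (m * card X)"
    using card_linked_subsets(1)[OF f X m] by (intro count) simp
  show "card {(A, B) \<in> linked_pairs X k N m f. P \<subseteq> A \<and> {z} \<subseteq> B}
      = ((card X - card P) choose (k - card P)) * (m * k)" if "z \<in> X"
    using card_linked_subsets(2)[OF f X m _ _ that] by (intro count) simp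
qed

section \<open>The doubled design\<close>

text \<open>
  The equation \<open>balance\<close> says that triples inside one copy and triples that meet both copies lie in
  the same number of blocks. By the symmetry of the construction it suffices to consider triples
  with at most one point in the second copy.
\<close>

lemma doubled_design:
  assumes D: "family_design 3 v (2 * k) L X D" and k: "k \<ge> 3"
    and f: "equipoint_colouring X k N f" and m: "m \<le> N"
    and balance: "L + ((v - 3) choose (k - 3)) * (m * v) = ((v - 2) choose (k - 2)) * (m * k)"
  shows "\<exists>F. family_design 3 (2 * v) (2 * k) (((v - 2) choose (k - 2)) * (m * k)) (X <+> X) F"
proof -
  have X: "finite X" "card X = v" and Dsub: "\<And>b. b \<in> D \<Longrightarrow> b \<subseteq> X \<and> card b = 2 * k"
    and Dbal: "\<And>T. T \<subseteq> X \<Longrightarrow> card T = 3 \<Longrightarrow> card {b\<in>D. T \<subseteq> b} = L"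
    using D by (auto simp: family_design_def)
  have finD: "finite D" by (rule family_design_finite[OF D])
  define M where "M = linked_pairs X k N m f"
  have finM: "finite M"
    by (rule finite_subset[of _ "Pow X \<times> Pow X"]) (auto simp: M_def linked_pairs_def X)
  define G where "G = D \<times> {{}} \<union> {{}} \<times> D \<union> M"
  define F where "F = (\<lambda>(A, B). A <+> B) ` G"
  have Plus_sub: "P <+> Q \<subseteq> A <+> B \<longleftrightarrow> P \<subseteq> A \<and> Q \<subseteq> B" for P Q A B :: "'a set"
    by auto
  have Plus_eq: "P <+> Q = A <+> B \<longleftrightarrow> P = A \<and> Q = B" for P Q A B :: "'a set"
    using Plus_sub by (metis subset_antisym subset_refl)
  have ne: "{} \<notin> D" using Dsub[of "{}"] k by auto
  have neM: "A \<noteq> {} \<and> B \<noteq> {}" if "(A, B) \<in> M" for A B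
    using that k by (auto simp: M_def linked_pairs_def)
  \<comment> \<open>The halves of a mixed block are nonempty, and so are the blocks in \<open>D\<close>; hence no block arises
    in two of the three ways and the counts add up.\<close>
  have split: "card {b\<in>F. P <+> Q \<subseteq> b}
      = card {b\<in>D. P \<subseteq> b \<and> Q = {}} + card {b\<in>D. Q \<subseteq> b \<and> P = {}}
        + card {(A, B) \<in> M. P \<subseteq> A \<and> Q \<subseteq> B}" for P Q
  proof -
    let ?G1 = "{b\<in>D. P \<subseteq> b \<and> Q = {}} \<times> {{} :: 'a set}"
    let ?G2 = "{{} :: 'a set} \<times> {b\<in>D. Q \<subseteq> b \<and> P = {}}"
    let ?G3 = "{(A, B) \<in> M. P \<subseteq> A \<and> Q \<subseteq> B}"
    let ?G = "{(A, B) \<in> G. P \<subseteq> A \<and> Q \<subseteq> B}"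
    have "{b\<in>F. P <+> Q \<subseteq> b} = (\<lambda>(A, B). A <+> B) ` ?G"
    proof (intro equalityI subsetI)
      fix b assume "b \<in> {b\<in>F. P <+> Q \<subseteq> b}"
      then obtain A B where "(A, B) \<in> G" "b = A <+> B" "P <+> Q \<subseteq> A <+> B"
        by (auto simp: F_def)
      then show "b \<in> (\<lambda>(A, B). A <+> B) ` ?G" unfolding Plus_sub by force
    next
      fix b assume "b \<in> (\<lambda>(A, B). A <+> B) ` ?G"
      then obtain A B where "(A, B) \<in> G" "b = A <+> B" "P \<subseteq> A" "Q \<subseteq> B" by auto
      then show "b \<in> {b\<in>F. P <+> Q \<subseteq> b}" unfolding F_def by force
    qed
    moreover have "inj_on (\<lambda>(A, B). A <+> B) ?G"
      by (intro inj_onI) (simp only: split_paired_all prod.case Plus_eq prod.inject)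
    ultimately have "card {b\<in>F. P <+> Q \<subseteq> b} = card ?G" by (simp add: card_image)
    also have "?G = (?G1 \<union> ?G2) \<union> ?G3" unfolding G_def by auto
    also have "card \<dots> = card (?G1 \<union> ?G2) + card ?G3"
    proof (rule card_Un_disjoint)
      show "finite ?G3" using finM by (rule rev_finite_subset) auto
      show "(?G1 \<union> ?G2) \<inter> ?G3 = {}" using neM by blast
    qed (use finD in simp)
    also have "card (?G1 \<union> ?G2) = card ?G1 + card ?G2"
    proof (rule card_Un_disjoint)
      show "?G1 \<inter> ?G2 = {}" using ne by blast
    qed (use finD in simp_all)
    finally show ?thesis by (simp only: card_cartesian_product card_cartesian_product_singleton) simp
  qed
  have swap: "card {(A, B) \<in> M. P \<subseteq> A \<and> Q \<subseteq> B} = card {(A, B) \<in> M. Q \<subseteq> A \<and> P \<subseteq> B}" for P Q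
    unfolding M_def by (rule card_linked_pairs_swap)
  have swapF: "card {b\<in>F. P <+> Q \<subseteq> b} = card {b\<in>F. Q <+> P \<subseteq> b}" for P Q
    unfolding split swap[of P Q] by simp
  let ?l = "((v - 2) choose (k - 2)) * (m * k)"
  have main: "card {b\<in>F. P <+> Q \<subseteq> b} = ?l"
    if PQ: "P \<subseteq> X" "Q \<subseteq> X" "card P + card Q = 3" "card Q \<le> 1" for P Q
  proof (cases "card Q = 0")
    case True
    then have Q: "Q = {}" using PQ X by (meson card_eq_0_iff finite_subset)
    have P: "card P = 3" "P \<noteq> {}" using PQ True by auto
    show ?thesis
      using card_linked_pairs_containing(1)[OF f X(1) m PQ(1)] P k balance Dbal[OF PQ(1)]
      by (simp add: split Q M_def X)
  next
    case False
    then have "card Q = 1" using PQ by simp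
    then obtain z where Q: "Q = {z}" by (rule card_1_singletonE)
    have P: "card P = 2" "P \<noteq> {}" using PQ Q by auto
    show ?thesis
      using card_linked_pairs_containing(2)[OF f X(1) m PQ(1), of z] P k PQ(2)
      by (simp add: split Q M_def X)
  qed
  have bal: "card {b\<in>F. T \<subseteq> b} = ?l" if T: "T \<subseteq> X <+> X" "card T = 3" for T
  proof -
    define P Q where "P = {x. Inl x \<in> T}" and "Q = {x. Inr x \<in> T}"
    have TPQ: "T = P <+> Q"
    proof (rule set_eqI)
      fix x show "x \<in> T \<longleftrightarrow> x \<in> P <+> Q" by (cases x) (auto simp: P_def Q_def)
    qed
    have PQ: "P \<subseteq> X" "Q \<subseteq> X" using T(1) by (auto simp: P_def Q_def)
    then have "finite P" "finite Q" using X finite_subset by auto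
    then have "card P + card Q = 3" using T(2) by (simp add: TPQ card_Plus)
    then consider "card Q \<le> 1" "card P + card Q = 3" | "card P \<le> 1" "card Q + card P = 3"
      by linarith
    then show ?thesis
    proof cases
      case 1
      then show ?thesis using main[OF PQ] by (simp add: TPQ)
    next
      case 2
      then show ?thesis using main[OF PQ(2,1)] swapF[of P Q] by (simp add: TPQ)
    qed
  qed
  have "b \<subseteq> X <+> X \<and> card b = 2 * k" if "b \<in> F" for b
  proof -
    obtain p where "p \<in> G" "b = (case p of (A, B) \<Rightarrow> A <+> B)"
      using \<open>b \<in> F\<close> unfolding F_def by (rule imageE)
    then obtain A B where AB: "(A, B) \<in> G" "b = A <+> B" by (cases p) simp
    then have sub: "A \<subseteq> X" "B \<subseteq> X" and "card A + card B = 2 * k"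
      using Dsub by (auto simp: G_def M_def linked_pairs_def)
    moreover have "finite A" "finite B" using sub X finite_subset by auto
    ultimately show ?thesis using AB(2) by (auto simp: card_Plus)
  qed
  then have "family_design 3 (2 * v) (2 * k) ?l (X <+> X) F"
    using X bal by (simp add: family_design_def card_Plus)
  then show ?thesis by blast
qed

text \<open>
  Both coefficients become multiples of \<open>(v - 3) choose (k - 2)\<close>, in which the value of \<open>\<Lambda>\<close> is
  expressed.
\<close>

lemma binomial_ratios:
  assumes "k \<ge> 3" and "v > k"
  shows "(v - k) * ((v - 2) choose (k - 2)) = (v - 2) * ((v - 3) choose (k - 2))"
    and "(v - k) * ((v - 3) choose (k - 3)) = (k - 2) * ((v - 3) choose (k - 2))"
proof -
  obtain j where j: "k = j + 3" using assms(1) by (metis add.commute le_Suc_ex)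
  have "v = j + (v - k - 1) + 4" using assms(2) j by simp
  then obtain d where d: "v = j + d + 4" by blast
  have "Suc d * (Suc (j + d) choose j) = Suc j * (Suc (j + d) choose Suc j)"
    using binomial_absorb_comp[of "Suc (j + d)" j] binomial_absorption[of j "Suc (j + d)"]
    by (simp del: binomial_Suc_Suc mult_Suc)
  then show "(v - k) * ((v - 3) choose (k - 3)) = (k - 2) * ((v - 3) choose (k - 2))"
    by (simp add: j d del: binomial_Suc_Suc mult_Suc)
  have "Suc d * (Suc (Suc (j + d)) choose Suc j) = Suc (Suc (j + d)) * (Suc (j + d) choose Suc j)"
    using binomial_absorb_comp[of "Suc (Suc (j + d))" "Suc j"]
    by (simp del: binomial_Suc_Suc mult_Suc)
  then show "(v - k) * ((v - 2) choose (k - 2)) = (v - 2) * ((v - 3) choose (k - 2))"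
    by (simp add: j d del: binomial_Suc_Suc mult_Suc)
qed

theorem theorem3p5:
  fixes v k \<Lambda> :: nat and m :: int
  assumes "k \<ge> 3" and "v > k" and "gcd v k = 1"
    and "\<exists>(X :: 'a set) \<B>. simple_t_design 3 v (2 * k) \<Lambda> X \<B>"
    and "real_of_int m = real \<Lambda> / (2 * real ((v - 3) choose (k - 2)))"
    and "real_of_int m \<le> 1 / real k * real ((v - 1) choose (k - 1))"
  shows "\<exists>\<Lambda>' :: nat.
           real \<Lambda>' = real k * (real v - 2) / (2 * (real v - real k)) * real \<Lambda> \<and>
           (\<exists>(Y :: nat set) \<C>. simple_t_design 3 (2 * v) (2 * k) \<Lambda>' Y \<C>)"
proof -
  let ?b = "(v - 3) choose (k - 2)" and ?c = "(v - 2) choose (k - 2)"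
    and ?d = "(v - 3) choose (k - 3)"
  define M where "M = nat m"
  have "real_of_int m \<ge> 0" using assms(5) by simp
  then have M: "real M = real_of_int m" by (simp add: M_def)
  have "?b > 0" using assms by (simp add: zero_less_binomial_iff)
  then have L: "real \<Lambda> = 2 * real M * real ?b" using assms(5) M by (simp add: field_simps)
  have rat: "(real v - real k) * real ?c = (real v - 2) * real ?b"
    "(real v - real k) * real ?d = (real k - 2) * real ?b"
    using binomial_ratios[OF assms(1,2), THEN arg_cong[of _ _ real]] assms(1,2)
    by (simp_all add: of_nat_diff)
  have pos: "real v - real k > 0" using assms(2) by simp
  have "(real v - real k) * (real \<Lambda> + real ?d * (M * v)) = (real v - real k) * (real ?c * (M * k))"
  proof -
    have "(real v - real k) * (real \<Lambda> + real ?d * (M * v))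
        = (real v - real k) * (2 * real M * real ?b) + ((real v - real k) * real ?d) * (M * v)"
      by (simp add: L algebra_simps)
    \<comment> \<open>Collecting the factor \<open>M * ?b\<close> leaves \<open>2 * (v - k) + (k - 2) * v = (v - 2) * k\<close>.\<close>
    also have "\<dots> = ((real v - 2) * real ?b) * (M * k)"
      unfolding rat(2) by (simp add: algebra_simps)
    also have "\<dots> = (real v - real k) * (real ?c * (M * k))"
      unfolding rat(1)[symmetric] by simp
    finally show ?thesis .
  qed
  then have "real (\<Lambda> + ?d * (M * v)) = real (?c * (M * k))" using pos by simp
  then have balance: "\<Lambda> + ?d * (M * v) = ?c * (M * k)" by (simp only: of_nat_eq_iff)
  obtain X :: "'a set" and \<B> where des: "simple_t_design 3 v (2 * k) \<Lambda> X \<B>"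
    using assms(4) by blast
  have X: "finite X" "card X = v" using des by (auto simp: simple_t_design_def t_design_def)
  obtain h where "bij_betw h X {0..<int v}"
    using finite_same_card_bij[of X "{0..<int v}"] X by auto
  then obtain D where D: "family_design 3 v (2 * k) \<Lambda> {0..<int v} D"
    using family_design_transport[OF family_design_of_simple_t_design[OF des]] by blast
  have "coprime v k" using assms(3) by (simp only: coprime_iff_gcd_eq_1)
  moreover have "v > 0" using assms(2) by simp
  ultimately obtain f N where f: "equipoint_colouring {0..<int v} k N f"
    by (rule equipoint_colouring_exists)
  have "N * k = (v - 1) choose (k - 1)"
    using equipoint_colouring_card[OF f] assms by simp
  then have "real M * real k \<le> real N * real k"
    using assms(1,6) M by (simp add: field_simps flip: of_nat_mult)
  then have MN: "M \<le> N" using assms(1) by simp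
  obtain F where F: "family_design 3 (2 * v) (2 * k) (?c * (M * k)) ({0..<int v} <+> {0..<int v}) F"
    using doubled_design[OF D assms(1) f MN balance] by blast
  let ?Y = "{0..<int v} <+> {0..<int v}"
  obtain e where "bij_betw e ?Y {0..<card ?Y}"
    using ex_bij_betw_finite_nat[of ?Y] by auto
  then have "simple_t_design 3 (2 * v) (2 * k) (?c * (M * k)) {0..<card ?Y} (mset_set ((`) e ` F))"
    using family_design_transport[OF F] simple_t_design_of_family_design by blast
  moreover have "real (?c * (M * k)) = real k * (real v - 2) / (2 * (real v - real k)) * real \<Lambda>"
  proof -
    have "x * (M * k) = k * y / (2 * w) * (2 * M * z)" if "w * x = y * z" "w > 0"
      for w x y z :: real
      using that by (simp add: field_simps)
    from this[OF rat(1) pos] show ?thesis by (simp add: L)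
  qed
  ultimately show ?thesis by blast
qed

end
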